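(* Let $T=(V,E)$ be a tree with at least two vertices. Then $$n(T)=2\prod_{v\in V}\deg(v)!\sum_{xy\in E}\frac{1}{\deg(x)\deg(y)},$$ where $\deg(v)$ is the degree of $v$ in $T$ and the sum is over the edges of $T$.
   Context: A word $w$ over the alphabet $V$ word-represents a graph $G=(V,E)$ if $w$ contains every letter of $V$ at least once and for all distinct $x,y\in V$, $xy\in E$ if and only if $x$ and $y$ alternate in $w$ (the subword of $w$ consisting only of occurrences of $x$ and $y$ has no two equal consecutive letters). $\ell(G)$ is the minimum length of a word that word-represents $G$, and $n(G)$ is the number of words of length $\ell(G)$ that word-represent $G$. *)

theory Defs
  imports Complex_Main
begin

text \<open>
  A finite simple graph is a finite vertex set together with a set of
  two-element subsets of it. (The trees of \<open>Graph_Theory\<close> are not usable here: in a symmetric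
  digraph the closed walk \<open>u, v, u\<close> already counts as a cycle.)
\<close>

locale simple_graph =
  fixes V :: "'a set" and E :: "'a set set"
  assumes finite_vertices: "finite V"
    and edges_two_subsets: "E \<subseteq> {e. e \<subseteq> V \<and> card e = 2}"

definition vertex_degree :: "'a set set \<Rightarrow> 'a \<Rightarrow> nat" where
  "vertex_degree E v = card {e \<in> E. v \<in> e}"

definition is_walk :: "'a set \<Rightarrow> 'a set set \<Rightarrow> 'a list \<Rightarrow> bool" where
  "is_walk V E p \<longleftrightarrow> p \<noteq> [] \<and> set p \<subseteq> V \<and> successively (\<lambda>x y. {x, y} \<in> E) p"

definition graph_connected :: "'a set \<Rightarrow> 'a set set \<Rightarrow> bool" where
  "graph_connected V E \<longleftrightarrow> V \<noteq> {} \<and>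
     (\<forall>u\<in>V. \<forall>v\<in>V. \<exists>p. is_walk V E p \<and> hd p = u \<and> last p = v)"

text \<open>A cycle is listed without repeating its first vertex at the end.\<close>

definition is_graph_cycle :: "'a set \<Rightarrow> 'a set set \<Rightarrow> 'a list \<Rightarrow> bool" where
  "is_graph_cycle V E p \<longleftrightarrow>
     is_walk V E p \<and> distinct p \<and> 3 \<le> length p \<and> {last p, hd p} \<in> E"

locale simple_tree = simple_graph +
  assumes tree_connected: "graph_connected V E"
    and tree_no_cycle: "\<nexists>p. is_graph_cycle V E p"

definition alternate_in :: "'a list \<Rightarrow> 'a \<Rightarrow> 'a \<Rightarrow> bool" where
  "alternate_in w x y \<longleftrightarrow> distinct_adj (filter (\<lambda>z. z \<in> {x, y}) w)"

definition word_represents :: "'a list \<Rightarrow> 'a set \<Rightarrow> 'a set set \<Rightarrow> bool" where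
  "word_represents w V E \<longleftrightarrow> set w \<subseteq> V \<and> V \<subseteq> set w \<and>
     (\<forall>x\<in>V. \<forall>y\<in>V. x \<noteq> y \<longrightarrow> ({x, y} \<in> E \<longleftrightarrow> alternate_in w x y))"

text \<open>
  Not every graph is word-representable. For a graph that is not, \<open>min_repr_length\<close> is
  an unspecified number and \<open>num_min_repr\<close> is \<open>0\<close>.
\<close>

definition min_repr_length :: "'a set \<Rightarrow> 'a set set \<Rightarrow> nat" where
  "min_repr_length V E = (LEAST k. \<exists>w. word_represents w V E \<and> length w = k)"

definition num_min_repr :: "'a set \<Rightarrow> 'a set set \<Rightarrow> nat" where
  "num_min_repr V E = card {w. word_represents w V E \<and> length w = min_repr_length V E}"

end

theory Submission
  imports Defs
begin

text \<open>
  Letters occurring once alternate pairwise, so in a tree there are at most two of them, and they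
  form an edge. Hence a shortest word has length \<open>2|V| - 2\<close>: the two ends of some edge \<open>e\<close> occur
  once and all other letters twice. To count the words belonging to \<open>e\<close>, grow the tree from \<open>e\<close> by
  attaching leaves. A leaf \<open>v\<close> at \<open>u\<close> is added to a word by inserting two letters \<open>v\<close> such that \<open>u\<close> is
  the only letter occurring an odd number of times between them. The number of such places
  is \<open>deg u + 1\<close>, or \<open>deg u\<close> if \<open>u \<in> e\<close>, and this is itself proved along the growth: the
  insertion at a pair \<open>(i, j)\<close> of gaps splits both gaps, which turns the pair \<open>(i, j)\<close> into two pairs
  for \<open>u\<close>, creates two pairs for \<open>v\<close>, and keeps all other pairs, because pairs do not cross.
\<close>

section \<open>Parities at the gaps of a word\<close>

text \<open>Partially applied, \<open>prefix_odd w i\<close> is the parity vector of gap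
  \<open>i\<close>, a vector over the field of two elements. The vectors of two gaps differ exactly
  in the letters that occur an odd number of times between them.\<close>

definition prefix_odd :: "'a list \<Rightarrow> nat \<Rightarrow> 'a \<Rightarrow> bool" where
  "prefix_odd w i z \<longleftrightarrow> odd (count_list (take i w) z)"

text \<open>The two parity vectors are neighbours in the cube, along coordinate \<open>u\<close>.
  The quantifier runs over the whole letter type; letters that do not occur in \<open>w\<close>
  never make a difference.\<close>

definition separating_pairs :: "'a list \<Rightarrow> 'a \<Rightarrow> (nat \<times> nat) set" where
  "separating_pairs w u = {(i, j). i < j \<and> j \<le> length w \<and>
     (\<forall>z. prefix_odd w i z \<noteq> prefix_odd w j z \<longleftrightarrow> z = u)}"

definition insert_twice :: "'a \<Rightarrow> nat \<Rightarrow> nat \<Rightarrow> 'a list \<Rightarrow> 'a list" where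
  "insert_twice v i j w = take i w @ v # take (j - i) (drop i w) @ v # drop j w"

text \<open>The gaps of \<open>insert_twice v i j w\<close> are \<open>Suc h\<close> for \<open>i \<le> h \<le> j\<close>, between the two letters
  \<open>v\<close>, and \<open>outer_gap i h\<close> for \<open>h \<le> i\<close> or \<open>j \<le> h\<close>; here \<open>h\<close> is the gap of \<open>w\<close> underneath.\<close>

definition outer_gap :: "nat \<Rightarrow> nat \<Rightarrow> nat" where
  "outer_gap i h = (if h \<le> i then h else h + 2)"

lemma finite_separating_pairs: "finite (separating_pairs w u)"
  by (rule finite_subset[of _ "{..length w} \<times> {..length w}"])
    (auto simp: separating_pairs_def)

lemma not_prefix_odd: "v \<notin> set w \<Longrightarrow> \<not> prefix_odd w h v"
  by (metis count_list_0_iff even_zero in_set_takeD prefix_odd_def)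

lemma take_middle_drop:
  "i \<le> j \<Longrightarrow> take i w @ take (j - i) (drop i w) @ drop j w = w"
  by (metis append.assoc append_take_drop_id le_add_diff_inverse take_add)

lemma take_add_middle:
  "i \<le> h \<Longrightarrow> take h w = take i w @ take (h - i) (drop i w)"
  by (metis le_add_diff_inverse take_add)

lemma length_insert_twice: "i \<le> j \<Longrightarrow> j \<le> length w \<Longrightarrow> length (insert_twice v i j w) = length w + 2"
  by (auto simp: insert_twice_def)

text \<open>The prefix that ends at \<open>Suc h\<close> is \<open>take h w\<close> with exactly one
  of the new letters \<open>v\<close> inside.\<close>

lemma prefix_odd_inner:
  assumes "i \<le> h" "h \<le> j" "j \<le> length w"
  shows "prefix_odd (insert_twice v i j w) (Suc h) z \<longleftrightarrow> (prefix_odd w h z \<noteq> (z = v))"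
proof -
  have "take (Suc h) (insert_twice v i j w) = take i w @ v # take (h - i) (drop i w)"
    using assms by (simp add: insert_twice_def Suc_diff_le min_def)
  moreover note take_add_middle[OF assms(1), of w]
  ultimately show ?thesis by (auto simp: prefix_odd_def)
qed

text \<open>The prefix contains none or both of the new letters, so no parity changes.\<close>

lemma prefix_odd_outer:
  assumes "i < j" "j \<le> length w" "h \<le> i \<or> j \<le> h"
  shows "prefix_odd (insert_twice v i j w) (outer_gap i h) z \<longleftrightarrow> prefix_odd w h z"
proof (cases "h \<le> i")
  case True
  then show ?thesis using assms by (simp add: prefix_odd_def outer_gap_def insert_twice_def min_def)
next
  case False
  with assms have h: "j \<le> h" by simp
  have "take (h + 2) (insert_twice v i j w)
      = take i w @ v # take (j - i) (drop i w) @ v # take (h - j) (drop j w)"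
    using assms h False by (simp add: insert_twice_def min_def Suc_diff_le)
  moreover have "take h w = take i w @ take (j - i) (drop i w) @ take (h - j) (drop j w)"
    using h assms take_add_middle[of j h w] take_add_middle[of i j w] by simp
  ultimately show ?thesis using False by (auto simp: prefix_odd_def outer_gap_def)
qed

text \<open>The ranges for \<open>h\<close> overlap in \<open>i\<close> and \<open>j\<close>: each
  of these two gaps of \<open>w\<close> lies under one inner and one outer gap.\<close>

lemma gap_cases:
  assumes "i < j" "j \<le> n" "p \<le> n + 2"
  obtains (inner) h where "i \<le> h" "h \<le> j" "p = Suc h"
  | (outer) h where "h \<le> n" "h \<le> i \<or> j \<le> h" "p = outer_gap i h"
proof -
  consider "p \<le> i" | "i < p" "p \<le> Suc j" | "Suc j < p" by linarith
  then show thesis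
  proof cases
    case 1 then show ?thesis using assms by (intro outer[of p]) (auto simp: outer_gap_def)
  next
    case 2 then show ?thesis by (intro inner[of "p - 1"]) auto
  next
    case 3 then show ?thesis using assms by (intro outer[of "p - 2"]) (auto simp: outer_gap_def)
  qed
qed

section \<open>Separating pairs do not cross\<close>

text \<open>Every change of parity uses up an occurrence of \<open>z\<close>, and there are at most
  two.\<close>

lemma parity_changes_le_2:
  assumes "count_list w z \<le> 2" "i \<le> j" "j \<le> k" "k \<le> l"
  shows "prefix_odd w i z = prefix_odd w j z \<or> prefix_odd w j z = prefix_odd w k z
    \<or> prefix_odd w k z = prefix_odd w l z"
proof -
  define c where "c \<equiv> \<lambda>i. count_list (take i w) z"
  have mono: "c m \<le> c n" if "m \<le> n" for m n
    using take_add_middle[OF that, of w] by (simp add: c_def)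
  have "c l \<le> count_list w z"
    unfolding c_def by (metis append_take_drop_id count_list_append le_add1)
  then have "c i \<le> c j" "c j \<le> c k" "c k \<le> c l" "c l \<le> 2"
    using assms mono by auto
  then have "c i = c j \<or> c j = c k \<or> c k = c l"
    by linarith
  then show ?thesis unfolding prefix_odd_def c_def by metis
qed

text \<open>If the pairs crossed, the three factors between consecutive gaps would each contain some letter
  an odd number of times. No letter does so in all three factors, which leaves only
  \<open>{b}, {a, b}, {a}\<close> as the odd letters of the factors; but then none separates \<open>i\<close> from \<open>l\<close>.\<close>

lemma separating_pairs_noncrossing:
  assumes cnt: "\<And>z. count_list w z \<le> 2"
    and inj: "inj_on (prefix_odd w) {..length w}"
    and "(i, k) \<in> separating_pairs w a" "(j, l) \<in> separating_pairs w b"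
  shows "\<not> (i < j \<and> j < k \<and> k < l)"
proof
  assume less: "i < j \<and> j < k \<and> k < l"
  have l: "l \<le> length w" using assms(4) by (auto simp: separating_pairs_def)
  have ik: "prefix_odd w i z \<noteq> prefix_odd w k z \<longleftrightarrow> z = a" for z
    using assms(3) by (auto simp: separating_pairs_def)
  have jl: "prefix_odd w j z \<noteq> prefix_odd w l z \<longleftrightarrow> z = b" for z
    using assms(4) by (auto simp: separating_pairs_def)
  have ne: "\<exists>z. prefix_odd w m z \<noteq> prefix_odd w n z" if "m < n" "n \<le> l" for m n
  proof (rule ccontr)
    assume "\<not> ?thesis"
    then have "prefix_odd w m = prefix_odd w n" by auto
    with inj that l show False by (auto dest: inj_onD)
  qed
  have ch: "prefix_odd w i z = prefix_odd w j z \<or> prefix_odd w j z = prefix_odd w k z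
    \<or> prefix_odd w k z = prefix_odd w l z" for z
    using parity_changes_le_2[OF cnt] less by simp
  have "(\<exists>z. prefix_odd w i z \<noteq> prefix_odd w j z) \<and> (\<exists>z. prefix_odd w j z \<noteq> prefix_odd w k z) \<and>
    (\<exists>z. prefix_odd w k z \<noteq> prefix_odd w l z) \<and> (\<exists>z. prefix_odd w i z \<noteq> prefix_odd w l z)"
    by (intro conjI ne) (use less in auto)
  then show False using ik jl ch by metis
qed

section \<open>Separating pairs after an insertion\<close>

text \<open>As \<open>v\<close> is new, its parity tells inner gaps from outer ones. Within each
  kind, injectivity for \<open>w\<close> identifies the gap underneath.\<close>

lemma inj_on_prefix_odd_insert_twice:
  assumes inj: "inj_on (prefix_odd w) {..length w}"
    and v: "v \<notin> set w" and ij: "i < j" "j \<le> length w"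
  shows "inj_on (prefix_odd (insert_twice v i j w)) {..length (insert_twice v i j w)}"
proof (rule inj_onI)
  have nv: "\<not> prefix_odd w h v" for h
    using v by (rule not_prefix_odd)
  have injD: "g = h" if "\<And>z. prefix_odd w g z = prefix_odd w h z" "g \<le> length w" "h \<le> length w" for g h
    using inj_onD[OF inj, of g h] that by auto
  fix p q
  assume p: "p \<in> {..length (insert_twice v i j w)}" and q: "q \<in> {..length (insert_twice v i j w)}"
    and "prefix_odd (insert_twice v i j w) p = prefix_odd (insert_twice v i j w) q"
  then have eq: "prefix_odd (insert_twice v i j w) p z = prefix_odd (insert_twice v i j w) q z" for z
    by simp
  from p ij have p': "p \<le> length w + 2" by (simp add: length_insert_twice)
  from q ij have q': "q \<le> length w + 2" by (simp add: length_insert_twice)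
  from ij p' show "p = q"
  proof (cases rule: gap_cases)
    case p: (inner g)
    from ij q' show ?thesis
    proof (cases rule: gap_cases)
      case (inner h)
      then have "g = h" using p eq ij by (intro injD) (auto simp: prefix_odd_inner)
      then show ?thesis using p inner by simp
    next
      case (outer h)
      then show ?thesis using eq[of v] p ij nv by (auto simp: prefix_odd_inner prefix_odd_outer)
    qed
  next
    case p: (outer g)
    from ij q' show ?thesis
    proof (cases rule: gap_cases)
      case (inner h)
      then show ?thesis using eq[of v] p ij nv by (auto simp: prefix_odd_inner prefix_odd_outer)
    next
      case (outer h)
      then have "g = h" using p eq ij by (intro injD) (auto simp: prefix_odd_outer)
      then show ?thesis using p outer by simp
    qed
  qed
qed

text \<open>A pair for \<open>v\<close> joins an inner and an outer gap with equal parities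
  underneath, hence with the same gap of \<open>w\<close> underneath. Only \<open>i\<close> and
  \<open>j\<close> lie under both kinds, so the pairs are those around each inserted letter.\<close>

lemma card_separating_pairs_insert_twice_new:
  assumes inj: "inj_on (prefix_odd w) {..length w}"
    and v: "v \<notin> set w" and ij: "i < j" "j \<le> length w"
  shows "card (separating_pairs (insert_twice v i j w) v) = 2"
proof -
  let ?w = "insert_twice v i j w"
  have nv: "\<not> prefix_odd w h v" for h
    using v by (rule not_prefix_odd)
  have injD: "g = h" if "\<And>z. prefix_odd w g z = prefix_odd w h z" "g \<le> length w" "h \<le> length w" for g h
    using inj_onD[OF inj, of g h] that by auto
  have "separating_pairs ?w v = {(i, Suc i), (Suc j, j + 2)}"
  proof (intro equalityI subsetI)
    fix pq assume "pq \<in> separating_pairs ?w v"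
    then obtain p q where pq: "pq = (p, q)" "p < q" "q \<le> length w + 2"
      and eq: "\<And>z. prefix_odd ?w p z \<noteq> prefix_odd ?w q z \<longleftrightarrow> z = v"
      using ij by (auto simp: separating_pairs_def length_insert_twice)
    have p': "p \<le> length w + 2" using pq by simp
    from ij p' show "pq \<in> {(i, Suc i), (Suc j, j + 2)}"
    proof (cases rule: gap_cases)
      case p: (inner g)
      from ij pq(3) show ?thesis
      proof (cases rule: gap_cases)
        case (inner h)
        then show ?thesis using eq[of v] p ij nv by (auto simp: prefix_odd_inner prefix_odd_outer)
      next
        case (outer h)
        \<comment> \<open>Away from \<open>v\<close> the parities agree by \<open>eq\<close>; at
          \<open>v\<close> they agree because \<open>v\<close> does not occur in
          \<open>w\<close>.\<close>
        have "g = h"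
        proof (rule injD)
          fix z show "prefix_odd w g z = prefix_odd w h z"
            using eq[of z] p ij outer nv by (cases "z = v") (auto simp: prefix_odd_inner prefix_odd_outer)
        qed (use p outer ij in auto)
        then show ?thesis using p outer pq ij by (auto simp: outer_gap_def split: if_splits)
      qed
    next
      case p: (outer g)
      from ij pq(3) show ?thesis
      proof (cases rule: gap_cases)
        case (inner h)
        have "g = h"
        proof (rule injD)
          fix z show "prefix_odd w g z = prefix_odd w h z"
            using eq[of z] p ij inner nv by (cases "z = v") (auto simp: prefix_odd_inner prefix_odd_outer)
        qed (use p inner ij in auto)
        then show ?thesis using p inner pq ij by (auto simp: outer_gap_def split: if_splits)
      next
        case (outer h)
        then show ?thesis using eq[of v] p ij nv by (auto simp: prefix_odd_inner prefix_odd_outer)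
      qed
    qed
  next
    fix pq assume "pq \<in> {(i, Suc i), (Suc j, j + 2)}"
    \<comment> \<open>Here \<open>i\<close> is \<open>outer_gap i i\<close> and \<open>j + 2\<close>
      is \<open>outer_gap i j\<close>.\<close>
    moreover have "prefix_odd ?w i z = prefix_odd w i z" "prefix_odd ?w (j + 2) z = prefix_odd w j z" for z
      using ij prefix_odd_outer[of i j w i v z] prefix_odd_outer[of i j w j v z]
      by (auto simp: outer_gap_def)
    ultimately show "pq \<in> separating_pairs ?w v"
      using ij nv by (auto simp: separating_pairs_def length_insert_twice prefix_odd_inner)
  qed
  then show ?thesis using ij by simp
qed

text \<open>A pair for \<open>a \<noteq> v\<close> does not change the parity of \<open>v\<close>,
  so both of its gaps are inner or both are outer. Underneath lie the pairs of \<open>w\<close> in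
  \<open>I\<close> and in \<open>J\<close>. Since pairs do not cross, \<open>I\<close> and
  \<open>J\<close> cover all pairs for \<open>a\<close>, and they share only \<open>(i, j)\<close>,
  which is a pair for \<open>u\<close> alone.\<close>

lemma card_separating_pairs_insert_twice:
  assumes cnt: "\<And>z. count_list w z \<le> 2"
    and inj: "inj_on (prefix_odd w) {..length w}"
    and v: "v \<notin> set w" and ij: "(i, j) \<in> separating_pairs w u" and a: "a \<noteq> v"
  shows "card (separating_pairs (insert_twice v i j w) a)
    = card (separating_pairs w a) + (if a = u then 1 else 0)"
proof -
  let ?w = "insert_twice v i j w"
  have lt: "i < j" "j \<le> length w" using ij by (auto simp: separating_pairs_def)
  have nv: "\<not> prefix_odd w h v" for h
    using v by (rule not_prefix_odd)
  \<comment> \<open>Both ranges are closed at \<open>i\<close> and \<open>j\<close>, so that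
    \<open>(i, j)\<close> is counted in \<open>I\<close> and in \<open>J\<close>.\<close>
  define I where "I = separating_pairs w a \<inter> {i..j} \<times> {i..j}"
  define J where "J = separating_pairs w a \<inter> ({..i} \<union> {j..}) \<times> ({..i} \<union> {j..})"
  have og: "outer_gap i g < outer_gap i h \<longleftrightarrow> g < h" if "g \<le> i \<or> j \<le> g" "h \<le> i \<or> j \<le> h" for g h
    using that lt by (auto simp: outer_gap_def)
  have ogl: "outer_gap i h \<le> length w + 2 \<longleftrightarrow> h \<le> length w" if "h \<le> i \<or> j \<le> h" for h
    using that lt by (auto simp: outer_gap_def)
  have eq: "separating_pairs ?w a = map_prod Suc Suc ` I \<union> map_prod (outer_gap i) (outer_gap i) ` J"
  proof (intro equalityI subsetI)
    fix pq assume "pq \<in> separating_pairs ?w a"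
    then obtain p q where pq: "pq = (p, q)" "p < q" "q \<le> length w + 2"
      and eq: "\<And>z. prefix_odd ?w p z \<noteq> prefix_odd ?w q z \<longleftrightarrow> z = a"
      using lt by (auto simp: separating_pairs_def length_insert_twice)
    have p': "p \<le> length w + 2" using pq by simp
    from lt p' show "pq \<in> map_prod Suc Suc ` I \<union> map_prod (outer_gap i) (outer_gap i) ` J"
    proof (cases rule: gap_cases)
      case p: (inner g)
      from lt pq(3) show ?thesis
      proof (cases rule: gap_cases)
        case (inner h)
        have "prefix_odd w g z \<noteq> prefix_odd w h z \<longleftrightarrow> z = a" for z
          using eq[of z] p inner lt by (auto simp: prefix_odd_inner)
        then have "(g, h) \<in> I" using p inner pq lt by (auto simp: I_def separating_pairs_def)
        then show ?thesis using p inner pq by force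
      next
        case (outer h)
        then show ?thesis using eq[of v] p lt nv a by (auto simp: prefix_odd_inner prefix_odd_outer)
      qed
    next
      case p: (outer g)
      from lt pq(3) show ?thesis
      proof (cases rule: gap_cases)
        case (inner h)
        then show ?thesis using eq[of v] p lt nv a by (auto simp: prefix_odd_inner prefix_odd_outer)
      next
        case (outer h)
        have "prefix_odd w g z \<noteq> prefix_odd w h z \<longleftrightarrow> z = a" for z
          using eq[of z] p outer lt by (auto simp: prefix_odd_outer)
        then have "(g, h) \<in> J" using p outer pq lt og[of g h] by (auto simp: J_def separating_pairs_def)
        then show ?thesis using p outer pq by force
      qed
    qed
  next
    fix pq assume "pq \<in> map_prod Suc Suc ` I \<union> map_prod (outer_gap i) (outer_gap i) ` J"
    then show "pq \<in> separating_pairs ?w a"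
    proof
      assume "pq \<in> map_prod Suc Suc ` I"
      then obtain g h where pq: "pq = (Suc g, Suc h)" and gh: "(g, h) \<in> separating_pairs w a"
        and "i \<le> g" "g \<le> j" "i \<le> h" "h \<le> j" by (auto simp: I_def)
      then have "prefix_odd ?w (Suc g) z \<noteq> prefix_odd ?w (Suc h) z
          \<longleftrightarrow> prefix_odd w g z \<noteq> prefix_odd w h z" for z
        using prefix_odd_inner[of i g j w v z] prefix_odd_inner[of i h j w v z] lt by blast
      then show ?thesis using gh lt unfolding pq separating_pairs_def
        by (simp add: length_insert_twice)
    next
      assume "pq \<in> map_prod (outer_gap i) (outer_gap i) ` J"
      then obtain g h where pq: "pq = (outer_gap i g, outer_gap i h)"
        and gh: "(g, h) \<in> separating_pairs w a"
        and *: "g \<le> i \<or> j \<le> g" "h \<le> i \<or> j \<le> h" by (auto simp: J_def)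
      have "prefix_odd ?w (outer_gap i g) z \<noteq> prefix_odd ?w (outer_gap i h) z
          \<longleftrightarrow> prefix_odd w g z \<noteq> prefix_odd w h z" for z
        using prefix_odd_outer[OF lt *(1), of v z] prefix_odd_outer[OF lt *(2), of v z] by blast
      then show ?thesis using gh lt og[OF *] ogl[OF *(2)] unfolding pq separating_pairs_def
        by (simp add: length_insert_twice)
    qed
  qed
  have disj: "map_prod Suc Suc ` I \<inter> map_prod (outer_gap i) (outer_gap i) ` J = {}"
    using lt by (auto simp: I_def J_def outer_gap_def split: if_splits)
  have injI: "inj_on (map_prod Suc Suc) I" by (auto simp: inj_on_def)
  have injO: "inj_on (map_prod (outer_gap i) (outer_gap i)) J"
    using lt by (auto simp: inj_on_def J_def outer_gap_def split: if_splits)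
  have fin: "finite I" "finite J" by (auto simp: I_def J_def finite_separating_pairs)
  have "I \<union> J = separating_pairs w a"
  proof -
    \<comment> \<open>Otherwise one of \<open>g\<close>, \<open>h\<close> is strictly between
      \<open>i\<close> and \<open>j\<close> and the other is outside. Then the two pairs cross, in
      one of the two possible orders.\<close>
    have "(g, h) \<in> I \<union> J" if gh: "(g, h) \<in> separating_pairs w a" for g h
    proof -
      have "g < h" using gh by (auto simp: separating_pairs_def)
      then show ?thesis
        using gh lt separating_pairs_noncrossing[OF cnt inj ij gh]
          separating_pairs_noncrossing[OF cnt inj gh ij]
        by (auto simp: I_def J_def)
    qed
    then have "separating_pairs w a \<subseteq> I \<union> J" by (rule subrelI)
    then show ?thesis unfolding I_def J_def by blast
  qed
  moreover have "I \<inter> J = (if a = u then {(i, j)} else {})"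
  proof -
    have "(i, j) \<in> separating_pairs w a \<longleftrightarrow> a = u" using ij by (auto simp: separating_pairs_def)
    moreover have "I \<inter> J = separating_pairs w a \<inter> {(i, j)}"
      using lt by (auto simp: I_def J_def separating_pairs_def)
    ultimately show ?thesis by auto
  qed
  ultimately have "card I + card J = card (separating_pairs w a) + (if a = u then 1 else 0)"
    using card_Un_Int[OF fin] by (auto split: if_splits)
  moreover have "card (separating_pairs ?w a) = card I + card J"
    unfolding eq using card_Un_disjoint[OF _ _ disj] fin injI injO by (simp add: card_image)
  ultimately show ?thesis by simp
qed


section \<open>Attaching a leaf as a bijection on words\<close>

text \<open>For an edge \<open>e\<close> of a tree these turn out to be the shortest words in which
  the ends of \<open>e\<close> are the letters occurring once. The set \<open>e\<close> is separate
  from \<open>E\<close> so that it can stay fixed while the graph grows.\<close>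

definition edge_words :: "'a set \<Rightarrow> 'a set set \<Rightarrow> 'a set \<Rightarrow> 'a list set" where
  "edge_words V E e = {w. word_represents w V E \<and>
     (\<forall>z\<in>V. count_list w z = (if z \<in> e then 1 else 2))}"

lemma set_insert_twice: "i \<le> j \<Longrightarrow> set (insert_twice v i j w) = insert v (set w)"
proof -
  assume "i \<le> j"
  then have "set w = set (take i w @ take (j - i) (drop i w) @ drop j w)"
    by (simp only: take_middle_drop)
  then show ?thesis unfolding insert_twice_def by auto
qed

lemma count_list_insert_twice:
  assumes "i \<le> j"
  shows "count_list (insert_twice v i j w) z = count_list w z + (if z = v then 2 else 0)"
proof -
  have "count_list w z = count_list (take i w @ take (j - i) (drop i w) @ drop j w) z"
    using assms by (simp only: take_middle_drop)
  then show ?thesis unfolding insert_twice_def by auto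
qed

lemma filter_pair_replicate:
  "v \<notin> set xs \<Longrightarrow> filter (\<lambda>x. x \<in> {z, v}) xs = replicate (count_list xs z) z"
  by (induction xs) auto

lemma alternate_in_sym: "alternate_in w x y = alternate_in w y x"
  by (simp add: alternate_in_def insert_commute)

text \<open>Restricted to \<open>z\<close> and \<open>v\<close>, the word is \<open>z\<close>
  repeated \<open>a\<close> times, \<open>v\<close>, \<open>z\<close> repeated \<open>b\<close>
  times, \<open>v\<close>, \<open>z\<close> repeated \<open>c\<close> times. If \<open>b = 0\<close>
  the two \<open>v\<close> are adjacent, if \<open>b = 2\<close> two \<open>z\<close> are; if
  \<open>b = 1\<close> then \<open>a + c\<close> is at most 1 and the word alternates.\<close>

lemma alternate_in_insert_twice_new:
  assumes v: "v \<notin> set w" and ij: "i \<le> j" "j \<le> length w"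
    and z: "z \<noteq> v" "count_list w z \<in> {1, 2}"
  shows "alternate_in (insert_twice v i j w) z v \<longleftrightarrow> (prefix_odd w i z \<noteq> prefix_odd w j z)"
proof -
  define A B C where "A = take i w" and "B = take (j - i) (drop i w)" and "C = drop j w"
  have w: "w = A @ B @ C" unfolding A_def B_def C_def using ij by (simp only: take_middle_drop)
  have j: "take j w = A @ B" unfolding A_def B_def using ij(1) by (rule take_add_middle)
  define a b c where "a = count_list A z" and "b = count_list B z" and "c = count_list C z"
  have "filter (\<lambda>x. x \<in> {z, v}) (insert_twice v i j w)
      = replicate a z @ v # replicate b z @ v # replicate c z"
    using v w unfolding insert_twice_def A_def[symmetric] B_def[symmetric] C_def[symmetric]
    by (simp add: a_def b_def c_def filter_pair_replicate[simplified])
  moreover have "a + b + c = 1 \<or> a + b + c = 2"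
    using z w by (simp add: a_def b_def c_def add.assoc)
  then have "a = 0 \<and> b = 0 \<and> c = 1 \<or> a = 0 \<and> b = 1 \<and> c = 0 \<or> a = 1 \<and> b = 0 \<and> c = 0 \<or>
    a = 0 \<and> b = 0 \<and> c = 2 \<or> a = 0 \<and> b = 2 \<and> c = 0 \<or> a = 2 \<and> b = 0 \<and> c = 0 \<or>
    a = 0 \<and> b = 1 \<and> c = 1 \<or> a = 1 \<and> b = 0 \<and> c = 1 \<or> a = 1 \<and> b = 1 \<and> c = 0"
    by presburger
  then have "distinct_adj (replicate a z @ v # replicate b z @ v # replicate c z) \<longleftrightarrow> odd b"
    using z(1) by (elim disjE) (auto simp: numeral_2_eq_2)
  moreover have "(prefix_odd w i z \<noteq> prefix_odd w j z) \<longleftrightarrow> odd b"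
    unfolding prefix_odd_def j by (auto simp: A_def[symmetric] b_def)
  ultimately show ?thesis unfolding alternate_in_def by simp
qed

lemma alternate_in_insert_twice_old:
  assumes "i \<le> j" "x \<noteq> v" "y \<noteq> v"
  shows "alternate_in (insert_twice v i j w) x y \<longleftrightarrow> alternate_in w x y"
proof -
  have "filter (\<lambda>z. z \<in> {x, y}) w
      = filter (\<lambda>z. z \<in> {x, y}) (take i w @ take (j - i) (drop i w) @ drop j w)"
    using assms by (simp only: take_middle_drop)
  then show ?thesis using assms unfolding alternate_in_def insert_twice_def by simp
qed

text \<open>Pairs of old letters keep their restricted words and their adjacency. For a pair
  \<open>z\<close>, \<open>v\<close>, alternation means that \<open>z\<close> is odd between the two
  letters \<open>v\<close>, and adjacency means \<open>z = u\<close>.\<close>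

lemma word_represents_insert_twice:
  assumes E: "E \<subseteq> Pow V" and v: "v \<notin> V" and u: "u \<in> V"
    and vw: "v \<notin> set w" and ij: "i \<le> j" "j \<le> length w"
    and cnt: "\<And>z. z \<in> V \<Longrightarrow> count_list w z \<in> {1, 2}"
  shows "word_represents (insert_twice v i j w) (insert v V) (insert {u, v} E) \<longleftrightarrow>
    word_represents w V E \<and> (\<forall>z\<in>V. prefix_odd w i z \<noteq> prefix_odd w j z \<longleftrightarrow> z = u)"
proof -
  let ?w = "insert_twice v i j w" and ?E = "insert {u, v} E"
  have nv: "z \<noteq> v" if "z \<in> V" for z using v that by auto
  have old: "({x, y} \<in> ?E \<longleftrightarrow> alternate_in ?w x y) \<longleftrightarrow> ({x, y} \<in> E \<longleftrightarrow> alternate_in w x y)"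
    if "x \<in> V" "y \<in> V" for x y
    using that nv[of x] nv[of y] ij by (auto simp: alternate_in_insert_twice_old doubleton_eq_iff)
  have new: "({z, v} \<in> ?E \<longleftrightarrow> alternate_in ?w z v)
      \<longleftrightarrow> (prefix_odd w i z \<noteq> prefix_odd w j z \<longleftrightarrow> z = u)" if "z \<in> V" for z
  proof -
    have "{z, v} \<in> ?E \<longleftrightarrow> z = u" using v E nv[OF that] by (auto simp: doubleton_eq_iff)
    then show ?thesis
      using alternate_in_insert_twice_new[OF vw ij nv[OF that] cnt[OF that]] by auto
  qed
  have new': "({v, z} \<in> ?E \<longleftrightarrow> alternate_in ?w v z)
      \<longleftrightarrow> (prefix_odd w i z \<noteq> prefix_odd w j z \<longleftrightarrow> z = u)" if "z \<in> V" for z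
    using new[OF that] by (simp only: insert_commute[of v z] alternate_in_sym[of ?w v z])
  have "set ?w \<subseteq> insert v V \<and> insert v V \<subseteq> set ?w \<longleftrightarrow> set w \<subseteq> V \<and> V \<subseteq> set w"
    using set_insert_twice[OF ij(1), of v w] v vw by auto
  moreover have "(\<forall>x\<in>insert v V. \<forall>y\<in>insert v V. x \<noteq> y \<longrightarrow> ({x, y} \<in> ?E \<longleftrightarrow> alternate_in ?w x y))
      \<longleftrightarrow> (\<forall>x\<in>V. \<forall>y\<in>V. x \<noteq> y \<longrightarrow> ({x, y} \<in> E \<longleftrightarrow> alternate_in w x y))
        \<and> (\<forall>z\<in>V. prefix_odd w i z \<noteq> prefix_odd w j z \<longleftrightarrow> z = u)"
    (is "?L \<longleftrightarrow> ?R")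
  proof -
    \<comment> \<open>The representation condition ranges over ordered pairs, so the pairs with
      \<open>v\<close> appear in both orders.\<close>
    define Q where "Q x y \<longleftrightarrow> ({x, y} \<in> ?E \<longleftrightarrow> alternate_in ?w x y)" for x y
    have "?L \<longleftrightarrow> (\<forall>x\<in>V. \<forall>y\<in>V. x \<noteq> y \<longrightarrow> Q x y) \<and> (\<forall>z\<in>V. Q z v \<and> Q v z)"
      unfolding Q_def[symmetric] using nv by auto
    also have "\<dots> \<longleftrightarrow> ?R"
      unfolding Q_def using old new new' by (simp cong: ball_cong)
    finally show ?thesis .
  qed
  ultimately show ?thesis
    by (simp only: word_represents_def conj_assoc[symmetric])
qed

lemma append_Cons_eq_first:
  assumes "x \<notin> set xs" "x \<notin> set xs'" "xs @ x # ys = xs' @ x # ys'"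
  shows "xs = xs' \<and> ys = ys'"
  using assms
proof (induction xs arbitrary: xs')
  case Nil
  then show ?case by (cases xs') auto
next
  case (Cons a xs)
  then show ?case by (cases xs') auto
qed

text \<open>The two letters \<open>v\<close> cut the word into three factors free of
  \<open>v\<close>. These factors are determined by the word, and their lengths give back the
  gaps.\<close>

lemma insert_twice_cancel:
  assumes "v \<notin> set w" "v \<notin> set w'" "i \<le> j" "j \<le> length w" "i' \<le> j'" "j' \<le> length w'"
    and eq: "insert_twice v i j w = insert_twice v i' j' w'"
  shows "w = w' \<and> i = i' \<and> j = j'"
proof -
  have "take i w = take i' w' \<and> take (j - i) (drop i w) = take (j' - i') (drop i' w')
      \<and> drop j w = drop j' w'"
  proof -
    have "v \<notin> set (take m w)" "v \<notin> set (take m w')" "v \<notin> set (take m (drop n w))"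
      "v \<notin> set (take m (drop n w'))" "v \<notin> set (drop m w)" "v \<notin> set (drop m w')" for m n
      using assms(1,2) by (meson in_set_takeD in_set_dropD)+
    then show ?thesis
      using eq unfolding insert_twice_def by (metis append_Cons_eq_first)
  qed
  then have *: "take i w = take i' w'" "take (j - i) (drop i w) = take (j' - i') (drop i' w')"
      "drop j w = drop j' w'" by auto
  have "w = w'" using * assms take_middle_drop[of i j w] take_middle_drop[of i' j' w'] by metis
  moreover have "i = i'" using arg_cong[OF *(1), of length] assms by simp
  moreover have "j - i = j' - i'" using arg_cong[OF *(2), of length] assms by simp
  ultimately show ?thesis using assms by simp
qed

lemma insert_twice_exhaust:
  assumes "count_list w v = 2"
  obtains w' i j where "w = insert_twice v i j w'" "v \<notin> set w'" "i \<le> j" "j \<le> length w'"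
proof -
  have "v \<in> set w" using assms count_notin by fastforce
  then obtain A R where w: "w = A @ v # R" "v \<notin> set A" by (metis split_list_first)
  then have R: "count_list R v = 1" using assms by simp
  then have "v \<in> set R" using count_notin by fastforce
  then obtain B C where "R = B @ v # C" "v \<notin> set B" by (metis split_list_first)
  with w R show ?thesis
    by (intro that[of "length A" "length A + length B" "A @ B @ C"])
      (auto simp: insert_twice_def count_list_0_iff)
qed

text \<open>The inverse map deletes the two occurrences of \<open>v\<close>; there are exactly two
  because \<open>v\<close> is not in \<open>e\<close>.\<close>

lemma bij_betw_insert_twice:
  assumes E: "E \<subseteq> Pow V" and v: "v \<notin> V" and u: "u \<in> V" and e: "e \<subseteq> V"
  shows "bij_betw (\<lambda>(w, i, j). insert_twice v i j w)
    (SIGMA w:edge_words V E e. separating_pairs w u)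
    (edge_words (insert v V) (insert {u, v} E) e)"
proof (rule bij_betw_imageI)
  have vw: "v \<notin> set w" if "w \<in> edge_words V E e" for w
    using that v by (auto simp: edge_words_def word_represents_def)
  have ve: "v \<notin> e" using v e by auto
  show "inj_on (\<lambda>(w, i, j). insert_twice v i j w) (SIGMA w:edge_words V E e. separating_pairs w u)"
    using vw by (auto intro!: inj_onI dest!: insert_twice_cancel[rotated -1] simp: separating_pairs_def)
  show "(\<lambda>(w, i, j). insert_twice v i j w) ` (SIGMA w:edge_words V E e. separating_pairs w u)
    = edge_words (insert v V) (insert {u, v} E) e"
  proof (intro equalityI subsetI)
    fix w' assume "w' \<in> (\<lambda>(w, i, j). insert_twice v i j w) ` (SIGMA w:edge_words V E e. separating_pairs w u)"
    then obtain w i j where w: "w \<in> edge_words V E e" "(i, j) \<in> separating_pairs w u"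
      and w': "w' = insert_twice v i j w" by auto
    have ij: "i \<le> j" "j \<le> length w" using w by (auto simp: separating_pairs_def)
    have "word_represents w' (insert v V) (insert {u, v} E)"
      unfolding w' using w ij vw[OF w(1)]
      by (subst word_represents_insert_twice[OF E v u])
        (auto simp: edge_words_def separating_pairs_def)
    then show "w' \<in> edge_words (insert v V) (insert {u, v} E) e"
      using w(1) ij vw[OF w(1)] v ve
      by (auto simp: edge_words_def w' count_list_insert_twice count_list_0_iff)
  next
    fix w' assume w': "w' \<in> edge_words (insert v V) (insert {u, v} E) e"
    then have "count_list w' v = 2" using ve by (auto simp: edge_words_def)
    then obtain w i j where w: "w' = insert_twice v i j w" "v \<notin> set w" and ij: "i \<le> j" "j \<le> length w"
      by (rule insert_twice_exhaust)
    have cnt: "count_list w z = (if z \<in> e then 1 else 2)" if "z \<in> V" for z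
      using w' that v ij by (auto simp: edge_words_def w count_list_insert_twice split: if_splits)
    have rep: "word_represents w V E" and sep: "\<forall>z\<in>V. prefix_odd w i z \<noteq> prefix_odd w j z \<longleftrightarrow> z = u"
      using w' word_represents_insert_twice[OF E v u w(2) ij] cnt by (auto simp: edge_words_def w)
    \<comment> \<open>This extends \<open>sep\<close> from \<open>V\<close> to all letters of the
      type, as \<open>separating_pairs\<close> demands.\<close>
    have "\<not> prefix_odd w i z" "\<not> prefix_odd w j z" if "z \<notin> V" for z
      using rep that not_prefix_odd[of z w] by (auto simp: word_represents_def)
    then have "\<forall>z. prefix_odd w i z \<noteq> prefix_odd w j z \<longleftrightarrow> z = u" using sep u by metis
    \<comment> \<open>Equal gaps would not separate \<open>u\<close>.\<close>
    moreover from this have "i \<noteq> j" by auto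
    ultimately have "(i, j) \<in> separating_pairs w u" using ij by (auto simp: separating_pairs_def)
    moreover have "w \<in> edge_words V E e" using rep cnt by (auto simp: edge_words_def)
    ultimately show "w' \<in> (\<lambda>(w, i, j). insert_twice v i j w) ` (SIGMA w:edge_words V E e. separating_pairs w u)"
      using w(1) by force
  qed
qed

section \<open>Growing a tree from an edge and counting its words\<close>

text \<open>The first tree is the edge \<open>e\<close> alone, with \<open>e\<close> as its vertex
  set. As a parameter, \<open>e\<close> stays the same in the whole growth.\<close>

inductive grown_tree :: "'a set \<Rightarrow> 'a set \<Rightarrow> 'a set set \<Rightarrow> bool" for e where
  edge: "card e = 2 \<Longrightarrow> grown_tree e e {e}"
| leaf: "grown_tree e V E \<Longrightarrow> v \<notin> V \<Longrightarrow> u \<in> V \<Longrightarrow> grown_tree e (insert v V) (insert {u, v} E)"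

lemma grown_treeD:
  assumes "grown_tree e V E"
  shows "finite V" "E \<subseteq> Pow V" "finite E" "e \<subseteq> V" "card e = 2"
proof -
  have "finite V \<and> E \<subseteq> Pow V \<and> finite E \<and> e \<subseteq> V \<and> card e = 2"
    using assms by induction (auto intro: card_ge_0_finite)
  then show "finite V" "E \<subseteq> Pow V" "finite E" "e \<subseteq> V" "card e = 2" by auto
qed

lemma vertex_degree_leaf:
  assumes "E \<subseteq> Pow V" "finite E" "v \<notin> V" "u \<in> V"
  shows "vertex_degree (insert {u, v} E) z =
    (if z = v then 1 else if z = u then Suc (vertex_degree E u) else vertex_degree E z)"
proof -
  have "{f \<in> insert {u, v} E. z \<in> f} =
    (if z = v then {{u, v}} else if z = u then insert {u, v} {f \<in> E. u \<in> f} else {f \<in> E. z \<in> f})"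
    using assms by auto
  moreover have "{u, v} \<notin> E" using assms by auto
  ultimately show ?thesis using assms by (auto simp: vertex_degree_def)
qed

text \<open>The odd letters at the three gaps are none, \<open>x\<close>, and both \<open>x\<close>
  and \<open>y\<close>. Consecutive gaps differ in one letter, the outer two in both
  letters.\<close>

lemma two_letter_word:
  assumes xy: "x \<noteq> y"
  shows "inj_on (prefix_odd [x, y]) {..length [x, y]}"
    "separating_pairs [x, y] x = {(0, 1)}" "separating_pairs [x, y] y = {(1, 2)}"
proof -
  have 0: "prefix_odd [x, y] 0 z \<longleftrightarrow> False" "prefix_odd [x, y] (Suc 0) z \<longleftrightarrow> z = x"
    "prefix_odd [x, y] 2 z \<longleftrightarrow> z = x \<or> z = y" for z
    using xy by (auto simp: prefix_odd_def)
  have l: "{..length [x, y]} = {0, Suc 0, 2}" by auto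
  show "inj_on (prefix_odd [x, y]) {..length [x, y]}"
    unfolding l using xy by (auto simp: inj_on_def fun_eq_iff 0)
  have c: "i < j \<and> j \<le> length [x, y] \<longleftrightarrow> (i, j) \<in> {(0, Suc 0), (0, 2), (Suc 0, 2)}" for i j :: nat
    by auto
  define P where "P i j u \<longleftrightarrow> (\<forall>z. prefix_odd [x, y] i z \<noteq> prefix_odd [x, y] j z \<longleftrightarrow> z = u)" for i j u
  have "P 0 (Suc 0) u \<longleftrightarrow> u = x" for u unfolding P_def 0 by blast
  moreover have "P (Suc 0) 2 u \<longleftrightarrow> u = y" for u unfolding P_def 0 using xy by blast
  moreover have "\<not> P 0 2 u" for u unfolding P_def 0 using xy by blast
  moreover have "separating_pairs [x, y] u
      = {(i, j). (i, j) \<in> {(0, Suc 0), (0, 2), (Suc 0, 2)} \<and> P i j u}" for u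
    unfolding separating_pairs_def conj_assoc[symmetric] c P_def ..
  ultimately show "separating_pairs [x, y] x = {(0, 1)}" "separating_pairs [x, y] y = {(1, 2)}"
    using xy by auto
qed

lemma edge_words_edge:
  assumes "x \<noteq> y"
  shows "edge_words {x, y} {{x, y}} {x, y} = {[x, y], [y, x]}"
proof (intro equalityI subsetI)
  fix w assume "w \<in> edge_words {x, y} {{x, y}} {x, y}"
  then have w: "set w = {x, y}" "count_list w x = 1" "count_list w y = 1"
    by (auto simp: edge_words_def word_represents_def)
  then have "length w = 2"
    using sum_count_set[of w "{x, y}"] assms by simp
  then obtain a b where ab: "w = [a, b]" by (auto simp: length_Suc_conv numeral_2_eq_2)
  then have "{a, b} = {x, y}" using w(1) by simp
  then show "w \<in> {[x, y], [y, x]}" unfolding ab doubleton_eq_iff by blast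
next
  fix w assume "w \<in> {[x, y], [y, x]}"
  then show "w \<in> edge_words {x, y} {{x, y}} {x, y}"
    using assms by (auto simp: edge_words_def word_represents_def alternate_in_def insert_commute)
qed

text \<open>The number of pairs for \<open>u\<close> is the same in all words, so attaching a leaf
  at \<open>u\<close> multiplies the number of words by it. Injectivity is carried along because the
  update of the numbers of pairs rests on it. The count is stated as a product, which avoids
  division of natural numbers.\<close>

lemma grown_tree_edge_words:
  assumes "grown_tree e V E"
  shows "(\<forall>w\<in>edge_words V E e. inj_on (prefix_odd w) {..length w} \<and>
      (\<forall>z\<in>V. card (separating_pairs w z) = vertex_degree E z + (if z \<in> e then 0 else 1)))
    \<and> finite (edge_words V E e)
    \<and> card (edge_words V E e) * (\<Prod>z\<in>e. vertex_degree E z) = 2 * (\<Prod>z\<in>V. fact (vertex_degree E z))"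
  using assms
proof induction
  case edge
  then obtain x y where xy: "e = {x, y}" "x \<noteq> y" by (auto simp: card_2_iff)
  have deg: "vertex_degree {e} z = 1" if "z \<in> e" for z
  proof -
    have "{f \<in> {e}. z \<in> f} = {e}" using that by auto
    then show ?thesis by (simp add: vertex_degree_def)
  qed
  have "card (edge_words e {e} e) = 2" using xy by (simp add: edge_words_edge)
  then show ?case
    using deg xy two_letter_word[of x y] two_letter_word[of y x] by (auto simp: edge_words_edge)
next
  case (leaf V E v u)
  note T = grown_treeD[OF leaf.hyps(1)]
  let ?E = "insert {u, v} E" and ?W = "edge_words V E e"
  let ?P = "SIGMA w:?W. separating_pairs w u"
  note bij = bij_betw_insert_twice[OF T(2) leaf.hyps(2,3) T(4)]
  note deg = vertex_degree_leaf[OF T(2,3) leaf.hyps(2,3)]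
  have ve: "v \<notin> e" using T leaf.hyps by auto
  have IH: "inj_on (prefix_odd w) {..length w}"
    "\<And>z. z \<in> V \<Longrightarrow> card (separating_pairs w z) = vertex_degree E z + (if z \<in> e then 0 else 1)"
    if "w \<in> ?W" for w using leaf.IH that by auto
  have finW: "finite ?W" using leaf.IH by auto
  have new: "inj_on (prefix_odd w') {..length w'} \<and>
      (\<forall>z\<in>insert v V. card (separating_pairs w' z) = vertex_degree ?E z + (if z \<in> e then 0 else 1))"
    if "w' \<in> edge_words (insert v V) ?E e" for w'
  proof -
    from that obtain w i j where w: "w \<in> ?W" and ij: "(i, j) \<in> separating_pairs w u"
      and w': "w' = insert_twice v i j w"
      unfolding bij_betw_imp_surj_on[OF bij, symmetric] by auto
    have lt: "i < j" "j \<le> length w" using ij by (auto simp: separating_pairs_def)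
    have vw: "v \<notin> set w" using w leaf.hyps by (auto simp: edge_words_def word_represents_def)
    have "count_list w z \<le> 2" for z
      using w count_notin[of z w] by (cases "z \<in> V") (auto simp: edge_words_def word_represents_def)
    then have "card (separating_pairs w' z) = vertex_degree ?E z + (if z \<in> e then 0 else 1)"
      if "z \<in> insert v V" for z
      \<comment> \<open>For the new leaf, 2 is its degree plus one, as required outside
        \<open>e\<close>.\<close>
      using card_separating_pairs_insert_twice_new[OF IH(1)[OF w] vw lt]
        card_separating_pairs_insert_twice[OF _ IH(1)[OF w] vw ij, of z] IH(2)[OF w] that ve
      by (auto simp: w' deg)
    then show ?thesis
      using inj_on_prefix_odd_insert_twice[OF IH(1)[OF w] vw lt] by (simp add: w')
  qed
  have finP: "finite ?P" using finW finite_separating_pairs by (rule finite_SigmaI)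
  have "card (edge_words (insert v V) ?E e) = card ?P"
    using bij_betw_same_card[OF bij] by simp
  also have "\<dots> = (\<Sum>w\<in>?W. card (separating_pairs w u))"
    by (rule card_SigmaI) (simp_all add: finW finite_separating_pairs)
  also have "\<dots> = card ?W * (vertex_degree E u + (if u \<in> e then 0 else 1))"
    using IH(2) leaf.hyps by simp
  finally have card: "card (edge_words (insert v V) ?E e)
    = card ?W * (vertex_degree E u + (if u \<in> e then 0 else 1))" .
  have fe: "finite e" using T by (meson finite_subset)
  \<comment> \<open>If \<open>u\<close> is in \<open>e\<close>, the factor \<open>deg u\<close> for
    the places cancels against the old degree, and the new degree is \<open>deg u + 1\<close>.
    Otherwise there are \<open>deg u + 1\<close> places and the product over \<open>e\<close> is
    unchanged.\<close>
  have prod_e: "(vertex_degree E u + (if u \<in> e then 0 else 1)) * (\<Prod>z\<in>e. vertex_degree ?E z)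
     = Suc (vertex_degree E u) * (\<Prod>z\<in>e. vertex_degree E z)"
  proof (cases "u \<in> e")
    case True
    have "(\<Prod>z\<in>e - {u}. vertex_degree ?E z) = (\<Prod>z\<in>e - {u}. vertex_degree E z)"
      using ve by (intro prod.cong) (auto simp: deg)
    moreover have "u \<noteq> v" using True ve by auto
    ultimately show ?thesis
      using True by (simp add: prod.remove[OF fe True] deg[of u] algebra_simps)
  next
    case False
    then have "(\<Prod>z\<in>e. vertex_degree ?E z) = (\<Prod>z\<in>e. vertex_degree E z)"
      using ve by (intro prod.cong) (auto simp: deg)
    then show ?thesis using False by simp
  qed
  \<comment> \<open>The factorial at \<open>u\<close> gains the factor \<open>deg u + 1\<close>, and
    the leaf contributes the factorial of 1.\<close>
  have prod_V: "(\<Prod>z\<in>insert v V. fact (vertex_degree ?E z) :: nat)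
     = Suc (vertex_degree E u) * (\<Prod>z\<in>V. fact (vertex_degree E z))"
  proof -
    have "(\<Prod>z\<in>V - {u}. fact (vertex_degree ?E z) :: nat) = (\<Prod>z\<in>V - {u}. fact (vertex_degree E z))"
      using leaf.hyps by (intro prod.cong) (auto simp: deg)
    moreover have "u \<noteq> v" using leaf.hyps by auto
    ultimately show ?thesis
      by (simp add: prod.insert[OF T(1) leaf.hyps(2)] prod.remove[OF T(1) leaf.hyps(3)] deg[of u] deg[of v] algebra_simps)
  qed
  have "card (edge_words (insert v V) ?E e) * (\<Prod>z\<in>e. vertex_degree ?E z)
    = 2 * (\<Prod>z\<in>insert v V. fact (vertex_degree ?E z))"
    unfolding card prod_V mult.assoc prod_e using leaf.IH by (simp add: algebra_simps)
  moreover have "finite (edge_words (insert v V) ?E e)"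
    using bij_betw_finite[OF bij] finP by simp
  ultimately show ?case using new by blast
qed

text \<open>Paths to \<open>u\<close> extend to the new leaf. They serve to close any further edge
  to a cycle.\<close>

lemma grown_tree_path:
  assumes "grown_tree e V E" "a \<in> V" "b \<in> V"
  shows "\<exists>p. is_walk V E p \<and> distinct p \<and> hd p = a \<and> last p = b"
  using assms
proof (induction arbitrary: a b)
  case edge
  then obtain x y where xy: "e = {x, y}" "x \<noteq> y" by (auto simp: card_2_iff)
  show ?case
  proof (cases "a = b")
    case True then show ?thesis using edge by (intro exI[of _ "[a]"]) (auto simp: is_walk_def)
  next
    case False then show ?thesis using edge xy by (intro exI[of _ "[a, b]"]) (auto simp: is_walk_def)
  qed
next
  case (leaf V E v u)
  have mono: "is_walk (insert v V) (insert {u, v} E) p" if "is_walk V E p" for p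
    using that by (auto simp: is_walk_def elim: successively_mono)
  have vp: "v \<notin> set p" if "is_walk V E p" for p using that leaf.hyps by (auto simp: is_walk_def)
  consider "a \<in> V" "b \<in> V" | "a = v" "b = v" | "a \<in> V" "b = v" | "a = v" "b \<in> V"
    using leaf.prems by auto
  then show ?case
  proof cases
    case 1 then show ?thesis using leaf.IH mono by blast
  next
    case 2 then show ?thesis by (intro exI[of _ "[v]"]) (auto simp: is_walk_def)
  next
    case 3
    then obtain p where "is_walk V E p" "distinct p" "hd p = a" "last p = u"
      using leaf.IH leaf.hyps by blast
    then show ?thesis using 3 mono[of p] vp[of p]
      by (intro exI[of _ "p @ [v]"]) (auto simp: is_walk_def successively_append_iff)
  next
    case 4
    then obtain p where "is_walk V E p" "distinct p" "hd p = u" "last p = b"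
      using leaf.IH leaf.hyps by blast
    then show ?thesis using 4 mono[of p] vp[of p]
      by (intro exI[of _ "v # p"]) (auto simp: is_walk_def successively_Cons insert_commute)
  qed
qed

lemma distinct_if_count_list_le_1:
  assumes "\<And>z. count_list xs z \<le> 1"
  shows "distinct xs"
  using assms
proof (induction xs)
  case (Cons a xs)
  have "count_list xs z \<le> 1" for z
    using Cons.prems[of z] by (simp split: if_splits)
  moreover have "a \<notin> set xs"
    using Cons.prems[of a] by (simp add: count_list_0_iff)
  ultimately show ?case using Cons.IH by simp
qed simp

text \<open>The restricted word has no repeated letter at all.\<close>

lemma alternate_in_once:
  assumes "count_list w x = 1" "count_list w y = 1" "x \<noteq> y"
  shows "alternate_in w x y"
proof -
  let ?f = "filter (\<lambda>z. z \<in> {x, y}) w"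
  have "count_list ?f z = (if z \<in> {x, y} then count_list w z else 0)" for z
    by (induction w) auto
  then have "count_list ?f z \<le> 1" for z using assms by auto
  then have "distinct ?f" by (rule distinct_if_count_list_le_1)
  then show ?thesis unfolding alternate_in_def distinct_adj_altdef by (rule remdups_adj_distinct)
qed

section \<open>Every tree grows from each of its edges\<close>

context simple_tree
begin

lemma finite_edges: "finite E"
  by (rule finite_subset[of _ "Pow V"]) (use edges_two_subsets finite_vertices in auto)

lemma walk_leaves:
  assumes "successively (\<lambda>x y. {x, y} \<in> E) p" "p \<noteq> []" "hd p \<in> U" "last p \<notin> U"
  obtains u v where "u \<in> U" "v \<notin> U" "{u, v} \<in> E"
  using assms
proof (induction p arbitrary: thesis)
  case (Cons a p)
  show ?case
  proof (cases "p \<noteq> [] \<and> hd p \<in> U")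
    case True
    then show ?thesis using Cons by (auto simp: successively_Cons)
  next
    case False
    then show ?thesis using Cons.prems by (auto simp: successively_Cons split: if_splits)
  qed
qed simp

text \<open>Take a grown subgraph with as many vertices as possible. By connectedness it spans
  \<open>V\<close>, since an edge leaving it would attach another leaf. By acyclicity it has all
  edges, since another edge would close a path to a cycle.\<close>

lemma grown_from_edge:
  assumes e: "e \<in> E"
  shows "grown_tree e V E"
proof -
  define P where "P = (\<lambda>U. \<exists>F. grown_tree e U F \<and> U \<subseteq> V \<and> F \<subseteq> E)"
  have "e \<subseteq> V" "card e = 2" using e edges_two_subsets by auto
  then have "P e" unfolding P_def using e grown_tree.edge by blast
  moreover have "\<forall>U. P U \<longrightarrow> card U < Suc (card V)"
    unfolding P_def using finite_vertices by (auto intro: card_mono simp: less_Suc_eq_le)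
  ultimately have "\<exists>U. P U \<and> (\<forall>U'. P U' \<longrightarrow> card U' \<le> card U)"
    by (rule ex_has_greatest_nat)
  then obtain U where U: "P U" and max: "\<And>U'. P U' \<Longrightarrow> card U' \<le> card U"
    by auto
  then obtain F where F: "grown_tree e U F" "U \<subseteq> V" "F \<subseteq> E" unfolding P_def by blast
  note T = grown_treeD[OF F(1)]
  have "U = V"
  proof (rule ccontr)
    assume "U \<noteq> V"
    then obtain b where b: "b \<in> V" "b \<notin> U" using F by auto
    obtain a where a: "a \<in> U" using T by (auto simp: card_2_iff)
    obtain p where "is_walk V E p" "hd p = a" "last p = b"
      using tree_connected a b F unfolding graph_connected_def by blast
    then obtain u v where uv: "u \<in> U" "v \<notin> U" "{u, v} \<in> E"
      using walk_leaves[of p U] a b by (auto simp: is_walk_def)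
    then have "v \<in> V" using edges_two_subsets by auto
    then have "P (insert v U)"
      unfolding P_def using F grown_tree.leaf[OF F(1) uv(2,1)] uv(3)
      by (intro exI[of _ "insert {u, v} F"]) simp
    then show False using max[of "insert v U"] uv T by simp
  qed
  moreover have "F = E"
  proof (rule ccontr)
    assume "F \<noteq> E"
    then obtain f where f: "f \<in> E" "f \<notin> F" using F by auto
    then obtain a b where ab: "f = {a, b}" "a \<noteq> b" "a \<in> V" "b \<in> V"
      using edges_two_subsets by (force simp: card_2_iff)
    obtain p where p: "is_walk U F p" "distinct p" "hd p = a" "last p = b"
      using grown_tree_path[OF F(1)] ab \<open>U = V\<close> by blast
    \<comment> \<open>A path with one vertex would give \<open>a = b\<close>, and one with two
      vertices would put \<open>f\<close> into \<open>F\<close>.\<close>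
    have "3 \<le> length p"
    proof (rule ccontr)
      assume "\<not> 3 \<le> length p"
      moreover have "length p \<noteq> 0" using p by (auto simp: is_walk_def)
      ultimately have "length p = 1 \<or> length p = 2" by linarith
      then show False using p ab f by (auto simp: length_Suc_conv numeral_2_eq_2 is_walk_def)
    qed
    moreover have "is_walk V E p"
      using p(1) F(3) \<open>U = V\<close> by (auto simp: is_walk_def elim: successively_mono)
    ultimately have "is_graph_cycle V E p"
      using p ab f by (simp add: is_graph_cycle_def insert_commute)
    then show False using tree_no_cycle by blast
  qed
  ultimately show ?thesis using F by simp
qed

lemma no_triangle:
  assumes "{a, b} \<in> E" "{b, c} \<in> E" "{c, a} \<in> E" "distinct [a, b, c]"
  shows False
proof -
  have "is_graph_cycle V E [a, b, c]"
    using assms edges_two_subsets by (auto simp: is_graph_cycle_def is_walk_def)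
  then show False using tree_no_cycle by blast
qed

lemma edge_exists:
  assumes "card V \<ge> 2"
  shows "E \<noteq> {}"
proof -
  obtain a b where ab: "a \<in> V" "b \<in> V" "a \<noteq> b"
    using assms by (metis card_2_iff' obtain_subset_with_card_n subsetD)
  then obtain p where "is_walk V E p" "hd p = a" "last p = b"
    using tree_connected unfolding graph_connected_def by blast
  \<comment> \<open>A walk from \<open>a\<close> to \<open>b\<close> leaves the set
    \<open>{a}\<close> along some edge.\<close>
  then show ?thesis
    using walk_leaves[of p "{a}" "E \<noteq> {}"] ab by (auto simp: is_walk_def)
qed

section \<open>The length of a shortest word\<close>

text \<open>Three such letters would be pairwise adjacent and form a triangle.\<close>

lemma once_letters_card:
  assumes "word_represents w V E"
  shows "card {z \<in> V. count_list w z = 1} \<le> 2"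
proof (rule ccontr)
  assume "\<not> ?thesis"
  then have "3 \<le> card {z \<in> V. count_list w z = 1}" by simp
  then obtain S where "S \<subseteq> {z \<in> V. count_list w z = 1}" "card S = 3"
    by (meson obtain_subset_with_card_n)
  then obtain a b c where abc: "{a, b, c} \<subseteq> {z \<in> V. count_list w z = 1}" "distinct [a, b, c]"
    by (auto simp: card_3_iff)
  have "{x, y} \<in> E" if "x \<in> {a, b, c}" "y \<in> {a, b, c}" "x \<noteq> y" for x y
    using assms alternate_in_once[of w x y] that abc by (auto simp: word_represents_def)
  then show False using no_triangle[of a b c] abc by auto
qed

text \<open>Add 1 to the count of each letter occurring once. Then every letter counts at least 2,
  and at most 2 has been added in total. In the case of equality there are exactly two such letters,
  all others occur twice, and the two are adjacent because they alternate.\<close>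

lemma length_word_represents:
  assumes w: "word_represents w V E"
  shows "2 * card V \<le> length w + 2"
    and "length w + 2 = 2 * card V \<Longrightarrow> \<exists>e\<in>E. w \<in> edge_words V E e"
proof -
  let ?S = "{z \<in> V. count_list w z = 1}"
  have sub: "set w \<subseteq> V" using w by (simp add: word_represents_def)
  have pos: "count_list w z \<ge> 1" if "z \<in> V" for z
    using w that count_list_0_iff[of w z] by (auto simp: word_represents_def Suc_le_eq)
  let ?h = "\<lambda>z. count_list w z + (if z \<in> ?S then 1 else 0)"
  have ge: "2 \<le> ?h z" if "z \<in> V" for z
    using pos[OF that] that by auto
  have sum: "(\<Sum>z\<in>V. ?h z) = length w + card ?S"
    using sum_count_set[OF sub finite_vertices] finite_vertices
    by (simp add: sum.distrib sum.If_cases Int_def)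
  have "2 * card V \<le> (\<Sum>z\<in>V. ?h z)"
    using sum_mono[of V "\<lambda>_. 2" ?h] ge by simp
  then show "2 * card V \<le> length w + 2" using sum once_letters_card[OF w] by linarith
  assume len: "length w + 2 = 2 * card V"
  \<comment> \<open>Equality of lengths makes both estimates tight.\<close>
  have "card ?S = 2" and eq: "(\<Sum>z\<in>V. ?h z) = (\<Sum>z\<in>V. 2)"
    using \<open>2 * card V \<le> (\<Sum>z\<in>V. ?h z)\<close> sum once_letters_card[OF w] len by auto
  have "?h z = 2" if "z \<in> V" for z
  proof (rule ccontr)
    assume "?h z \<noteq> 2"
    then have "(\<Sum>z\<in>V. 2) < (\<Sum>z\<in>V. ?h z)"
      using that ge[OF that] by (intro sum_strict_mono_ex1 finite_vertices bexI[of _ z] ballI ge)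
        (auto simp: le_neq_implies_less)
    then show False using eq by simp
  qed
  then have cnt: "count_list w z = (if z \<in> ?S then 1 else 2)" if "z \<in> V" for z
    using that by fastforce
  obtain x y where xy: "?S = {x, y}" "x \<noteq> y" using \<open>card ?S = 2\<close> by (auto simp: card_2_iff)
  then have "x \<in> ?S" "y \<in> ?S" by blast+
  then have "{x, y} \<in> E"
    using w alternate_in_once[of w x y] xy(2) by (auto simp: word_represents_def)
  moreover have "w \<in> edge_words V E {x, y}"
    using w cnt unfolding edge_words_def xy(1) by blast
  ultimately show "\<exists>e\<in>E. w \<in> edge_words V E e" by blast
qed

lemma length_edge_words:
  assumes "w \<in> edge_words V E e" "e \<in> E"
  shows "length w + 2 = 2 * card V"
proof -
  have w: "set w \<subseteq> V" "\<And>z. z \<in> V \<Longrightarrow> count_list w z = (if z \<in> e then 1 else 2)"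
    using assms by (auto simp: edge_words_def word_represents_def)
  have e: "e \<subseteq> V" "card e = 2" using assms edges_two_subsets by auto
  have "length w = (\<Sum>z\<in>V. if z \<in> e then 1 else 2)"
    using sum_count_set[OF w(1) finite_vertices] w(2) by simp
  then have "length w + card e = (\<Sum>z\<in>V. (if z \<in> e then 1 else 2) + (if z \<in> e then 1 else 0))"
    using e finite_vertices by (simp add: sum.distrib sum.If_cases Int_absorb1)
  also have "\<dots> = (\<Sum>z\<in>V. 2)" by (rule sum.cong) auto
  finally show ?thesis using e by simp
qed

text \<open>The edge can be read off the word: its ends are the letters that occur once.\<close>

lemma edge_words_disjoint:
  assumes "e \<in> E" "f \<in> E" "w \<in> edge_words V E e" "w \<in> edge_words V E f"
  shows "e = f"
proof -
  have "z \<in> e \<longleftrightarrow> z \<in> f" if "z \<in> V" for z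
    using assms that by (auto simp: edge_words_def split: if_splits)
  then show ?thesis using assms edges_two_subsets by blast
qed

section \<open>Counting the shortest words\<close>

lemma card_edge_words:
  assumes "e \<in> E"
  shows "real (card (edge_words V E e)) =
    2 * (\<Prod>v\<in>V. fact (vertex_degree E v)) * (1 / (\<Prod>v\<in>e. real (vertex_degree E v)))"
    and "finite (edge_words V E e)" and "edge_words V E e \<noteq> {}"
proof -
  note main = grown_tree_edge_words[OF grown_from_edge[OF assms]]
  then show fin: "finite (edge_words V E e)" by blast
  have eq: "card (edge_words V E e) * (\<Prod>z\<in>e. vertex_degree E z)
    = 2 * (\<Prod>z\<in>V. fact (vertex_degree E z))" using main by blast
  \<comment> \<open>A product of factorials is nonzero, so neither factor on the left of
    \<open>eq\<close> vanishes. This permits the division and shows that words for \<open>e\<close>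
    exist.\<close>
  have pos: "(\<Prod>z\<in>V. fact (vertex_degree E z) :: nat) \<noteq> 0"
    using finite_vertices by simp
  then have nz: "card (edge_words V E e) \<noteq> 0" "(\<Prod>z\<in>e. vertex_degree E z) \<noteq> 0"
    using eq by (metis mult_eq_0_iff zero_neq_numeral)+
  then show "edge_words V E e \<noteq> {}" by auto
  have "real (card (edge_words V E e)) * (\<Prod>v\<in>e. real (vertex_degree E v))
    = 2 * (\<Prod>v\<in>V. fact (vertex_degree E v))"
    using arg_cong[OF eq, of real] by (simp add: of_nat_fact)
  moreover have "(\<Prod>v\<in>e. real (vertex_degree E v)) \<noteq> 0"
    using nz(2) by (metis of_nat_eq_0_iff of_nat_prod)
  ultimately show "real (card (edge_words V E e)) =
    2 * (\<Prod>v\<in>V. fact (vertex_degree E v)) * (1 / (\<Prod>v\<in>e. real (vertex_degree E v)))"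
    by (simp add: field_simps)
qed

text \<open>The lower bound on the length is attained because the count for an edge is nonzero; that
  trees are word-representable thus comes out of the count.\<close>

lemma minimal_words:
  assumes "card V \<ge> 2"
  shows "{w. word_represents w V E \<and> length w = min_repr_length V E} = (\<Union>e\<in>E. edge_words V E e)"
proof -
  obtain e where e: "e \<in> E" using edge_exists[OF assms] by blast
  then obtain w where w: "w \<in> edge_words V E e" using card_edge_words(3) by blast
  have "min_repr_length V E = 2 * card V - 2"
    unfolding min_repr_length_def
  proof (rule Least_equality)
    show "\<exists>w. word_represents w V E \<and> length w = 2 * card V - 2"
      using w length_edge_words[OF w e] by (intro exI[of _ w]) (auto simp: edge_words_def)
  qed (use length_word_represents(1) in fastforce)
  then have "length w = min_repr_length V E \<longleftrightarrow> length w + 2 = 2 * card V" for w :: "'a list"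
    using assms by auto
  moreover have "word_represents w V E" if "w \<in> edge_words V E e" for w e
    using that by (simp add: edge_words_def)
  ultimately show ?thesis
    using length_word_represents(2) length_edge_words by (intro equalityI subsetI) auto
qed

end

theorem theorem4:
  fixes V :: "'a set" and E :: "'a set set"
  assumes "simple_tree V E"
    and "card V \<ge> 2"
  shows "real (num_min_repr V E) =
    2 * (\<Prod>v\<in>V. fact (vertex_degree E v)) *
      (\<Sum>e\<in>E. 1 / (\<Prod>v\<in>e. real (vertex_degree E v)))"
proof -
  interpret simple_tree V E by fact
  have "num_min_repr V E = card (\<Union>e\<in>E. edge_words V E e)"
    unfolding num_min_repr_def minimal_words[OF assms(2)] ..
  also have "\<dots> = (\<Sum>e\<in>E. card (edge_words V E e))"
    using finite_edges card_edge_words(2) edge_words_disjoint by (intro card_UN_disjoint) blast+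
  finally show ?thesis by (simp add: card_edge_words(1) sum_distrib_left)
qed

end
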